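(* Let $X$ be a real Banach space, $H$ a real Hilbert space (identified with its dual), $K\subseteq H$ a nonempty closed convex set, $F:X\to X^*$ continuously differentiable and $g:X\to H$ twice continuously differentiable, and let $M:=\{x\in X:g(x)\in K\}$. Assume that $g$ is concave with respect to $K_\infty$ and that, for every $y\in X$, the function $x\mapsto\langle F(x),x-y\rangle$ is weakly sequentially lower semicontinuous. Let $\{x^k\},\{\lambda^k\},\{w^k\},\{\rho_k\}$ be sequences generated by the augmented Lagrangian method, and assume that there is a null sequence $\{\varepsilon_k\}\subseteq[0,\infty)$ such that $\|\mathcal{L}_{\rho_k}(x^{k+1},w^k)\|_{X^*}\le\varepsilon_{k+1}$ for all $k$. Let $\bar{x}$ be a weak limit point of $\{x^k\}$. If the feasible set $M$ is nonempty, then $\bar{x}$ is feasible (that is, $\bar{x}\in M$) and $\bar{x}$ solves the variational inequality $$\text{find }x\in M\text{ such that }\langle F(x),v\rangle\ge 0\quad\forall v\in\mathcal{T}_M(x).$$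
   Context: $P_K$ is the metric projection onto $K$; $g'(x)^*:H\to X^*$ is the adjoint of the Fréchet derivative $g'(x)$. A weak limit point of $\{x^k\}$ is the weak limit of some subsequence. Tangent cone: for $x\in M$, $\mathcal{T}_M(x)=\{d\in X:\exists\, x^k\to x,\ t_k\downarrow 0,\ x^k\in M,\ (x^k-x)/t_k\to d\}$. (If $M$ is convex, the variational inequality is equivalent to: $x\in M$ and $\langle F(x),y-x\rangle\ge 0$ for all $y\in M$.) Concavity: $K_\infty:=\{y\in H:y+K\subseteq K\}$ is the recession cone, and $y\le_K z$ means $z-y\in K_\infty$. The mapping $g$ is concave (with respect to $K_\infty$) if $\alpha g(x)+(1-\alpha)g(y)\le_K g(\alpha x+(1-\alpha)y)$ for all $x,y\in X$, $\alpha\in[0,1]$. Augmented Lagrangian: for $\rho>0$, $$\mathcal{L}_\rho(x,\lambda):=F(x)+\rho\, g'(x)^*\Bigl[g(x)+\tfrac{\lambda}{\rho}-P_K\bigl(g(x)+\tfrac{\lambda}{\rho}\bigr)\Bigr]\in X^*,$$ $$V(x,\lambda,\rho):=\|\mathcal{L}_\rho(x,\lambda)\|_{X^*}+\bigl\|g(x)-P_K\bigl(g(x)+\tfrac{\lambda}{\rho}\bigr)\bigr\|_H.$$ Augmented Lagrangian method: given $(x^0,\lambda^0)\in X\times H$, a bounded set $B\subseteq H$, $\rho_0>0$, $\gamma>1$, $\tau\in(0,1)$, for $k=0,1,2,\dots$: (i) choose $w^k\in B$ and compute an inexact zero $x^{k+1}\in X$ of $\mathcal{L}_{\rho_k}(\cdot,w^k)$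 (the degree of inexactness is the one in the claim); (ii) set $\lambda^{k+1}:=\rho_k\bigl[g(x^{k+1})+\frac{w^k}{\rho_k}-P_K\bigl(g(x^{k+1})+\frac{w^k}{\rho_k}\bigr)\bigr]$; (iii) if $k=0$ or $V(x^{k+1},w^k,\rho_k)\le\tau V(x^k,w^{k-1},\rho_{k-1})$, set $\rho_{k+1}:=\rho_k$, otherwise set $\rho_{k+1}:=\gamma\rho_k$. The method is assumed to generate infinite sequences. *)

theory Defs
  imports "HOL-Analysis.Analysis"
begin

definition weakly_converges :: "(nat \<Rightarrow> 'a::real_normed_vector) \<Rightarrow> 'a \<Rightarrow> bool" where
  "weakly_converges u x \<longleftrightarrow>
     (\<forall>f :: 'a \<Rightarrow>\<^sub>L real. (\<lambda>n. blinfun_apply f (u n)) \<longlonglongrightarrow> blinfun_apply f x)"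

definition weak_limit_point :: "(nat \<Rightarrow> 'a::real_normed_vector) \<Rightarrow> 'a \<Rightarrow> bool" where
  "weak_limit_point u x \<longleftrightarrow> (\<exists>r :: nat \<Rightarrow> nat. strict_mono r \<and> weakly_converges (u \<circ> r) x)"

definition weakly_seq_lsc :: "('a::real_normed_vector \<Rightarrow> real) \<Rightarrow> bool" where
  "weakly_seq_lsc \<phi> \<longleftrightarrow>
     (\<forall>u x. weakly_converges u x \<longrightarrow> ereal (\<phi> x) \<le> liminf (\<lambda>n. ereal (\<phi> (u n))))"

text \<open>The library constant \<^const>\<open>closest_point\<close> is restricted to Heine-Borel spaces, that is, to
  finite dimension. For nonempty closed convex \<open>K\<close> in a Hilbert space the minimiser
  below exists and is unique.\<close>

definition metric_projection :: "'b::real_inner set \<Rightarrow> 'b \<Rightarrow> 'b" where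
  "metric_projection K y = arg_min_on (\<lambda>z. dist y z) K"

text \<open>The Banach space adjoint \<open>A\<^sup>* : H \<rightarrow> X\<^sup>*\<close> with \<open>H\<close> identified with its dual:
  \<open>(A\<^sup>* y) d = A d \<bullet> y\<close>. The library constant \<^const>\<open>adjoint\<close> needs an inner product on
  both spaces.\<close>

definition dual_adjoint ::
    "('a::real_normed_vector \<Rightarrow>\<^sub>L 'b::real_inner) \<Rightarrow> 'b \<Rightarrow> ('a \<Rightarrow>\<^sub>L real)" where
  "dual_adjoint A y = blinfun_inner_left y o\<^sub>L A"

definition recession_cone :: "'b::real_vector set \<Rightarrow> 'b set" where
  "recession_cone K = {y. (\<lambda>z. y + z) ` K \<subseteq> K}"

definition le_rec :: "'b::real_vector set \<Rightarrow> 'b \<Rightarrow> 'b \<Rightarrow> bool" where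
  "le_rec K y z \<longleftrightarrow> z - y \<in> recession_cone K"

definition concave_wrt_recession ::
    "'b::real_vector set \<Rightarrow> ('a::real_vector \<Rightarrow> 'b) \<Rightarrow> bool" where
  "concave_wrt_recession K g \<longleftrightarrow>
     (\<forall>x y. \<forall>\<alpha>\<in>{0..1::real}.
        le_rec K (\<alpha> *\<^sub>R g x + (1 - \<alpha>) *\<^sub>R g y) (g (\<alpha> *\<^sub>R x + (1 - \<alpha>) *\<^sub>R y)))"

definition feasible_set :: "('a \<Rightarrow> 'b) \<Rightarrow> 'b set \<Rightarrow> 'a set" where
  "feasible_set g K = {x. g x \<in> K}"

text \<open>Here \<open>t\<^sub>k \<down> 0\<close> is read as \<open>t\<^sub>k > 0\<close> and \<open>t\<^sub>k \<rightarrow> 0\<close>; requiring monotonicity in addition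
  would give the same cone, by passing to a subsequence.\<close>

definition tangent_cone :: "'a::real_normed_vector set \<Rightarrow> 'a \<Rightarrow> 'a set" where
  "tangent_cone M x =
     {d. \<exists>(u :: nat \<Rightarrow> 'a) (t :: nat \<Rightarrow> real).
           (\<forall>k. u k \<in> M) \<and> u \<longlonglongrightarrow> x \<and> (\<forall>k. 0 < t k) \<and> t \<longlonglongrightarrow> 0 \<and>
           (\<lambda>k. (u k - x) /\<^sub>R t k) \<longlonglongrightarrow> d}"

definition solves_VI ::
    "('a::real_normed_vector \<Rightarrow> 'a \<Rightarrow>\<^sub>L real) \<Rightarrow> 'a set \<Rightarrow> 'a \<Rightarrow> bool" where
  "solves_VI F M x \<longleftrightarrow> x \<in> M \<and> (\<forall>v\<in>tangent_cone M x. 0 \<le> blinfun_apply (F x) v)"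

text \<open>In what follows \<open>g'\<close> stands for the Frechet derivative of \<open>g\<close>.\<close>

definition aug_Lagrangian ::
    "('a::real_normed_vector \<Rightarrow> 'a \<Rightarrow>\<^sub>L real) \<Rightarrow> ('a \<Rightarrow> 'b::real_inner) \<Rightarrow> ('a \<Rightarrow> 'a \<Rightarrow>\<^sub>L 'b) \<Rightarrow>
     'b set \<Rightarrow> real \<Rightarrow> 'a \<Rightarrow> 'b \<Rightarrow> 'a \<Rightarrow>\<^sub>L real" where
  "aug_Lagrangian F g g' K \<rho> x \<mu> =
     F x + \<rho> *\<^sub>R dual_adjoint (g' x)
       (g x + \<mu> /\<^sub>R \<rho> - metric_projection K (g x + \<mu> /\<^sub>R \<rho>))"

definition alm_V ::
    "('a::real_normed_vector \<Rightarrow> 'a \<Rightarrow>\<^sub>L real) \<Rightarrow> ('a \<Rightarrow> 'b::real_inner) \<Rightarrow> ('a \<Rightarrow> 'a \<Rightarrow>\<^sub>L 'b) \<Rightarrow>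
     'b set \<Rightarrow> 'a \<Rightarrow> 'b \<Rightarrow> real \<Rightarrow> real" where
  "alm_V F g g' K x \<mu> \<rho> =
     norm (aug_Lagrangian F g g' K \<rho> x \<mu>) + norm (g x - metric_projection K (g x + \<mu> /\<^sub>R \<rho>))"

text \<open>The sequences generated by the method, apart from the inexactness of the zeros
  \<open>x (Suc k)\<close> of \<open>\<L>\<^bsub>\<rho> k\<^esub>(\<cdot>, w k)\<close>, which is a separate condition. The starting point
  \<open>(x 0, \<mu> 0)\<close> is arbitrary.\<close>

definition alm_sequences ::
    "('a::real_normed_vector \<Rightarrow> 'a \<Rightarrow>\<^sub>L real) \<Rightarrow> ('a \<Rightarrow> 'b::real_inner) \<Rightarrow> ('a \<Rightarrow> 'a \<Rightarrow>\<^sub>L 'b) \<Rightarrow>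
     'b set \<Rightarrow> 'b set \<Rightarrow> real \<Rightarrow> real \<Rightarrow>
     (nat \<Rightarrow> 'a) \<Rightarrow> (nat \<Rightarrow> 'b) \<Rightarrow> (nat \<Rightarrow> 'b) \<Rightarrow> (nat \<Rightarrow> real) \<Rightarrow> bool" where
  "alm_sequences F g g' K B \<gamma> \<tau> x \<mu> w \<rho> \<longleftrightarrow>
     bounded B \<and> 0 < \<rho> 0 \<and> 1 < \<gamma> \<and> 0 < \<tau> \<and> \<tau> < 1 \<and>
     (\<forall>k. w k \<in> B) \<and>
     (\<forall>k. \<mu> (Suc k) = \<rho> k *\<^sub>R
        (g (x (Suc k)) + w k /\<^sub>R \<rho> k - metric_projection K (g (x (Suc k)) + w k /\<^sub>R \<rho> k))) \<and>
     (\<forall>k. \<rho> (Suc k) =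
        (if k = 0 \<or> alm_V F g g' K (x (Suc k)) (w k) (\<rho> k)
                     \<le> \<tau> * alm_V F g g' K (x k) (w (k - 1)) (\<rho> (k - 1))
         then \<rho> k else \<gamma> * \<rho> k))"

end

theory Submission
  imports Defs
begin

text \<open>Write \<open>z\<close> for a new iterate, \<open>v\<close> and \<open>r\<close> for the multiplier estimate and the penalty parameter
  used to compute it, \<open>p\<close> for the projection of \<open>g z + v / r\<close> onto \<open>K\<close>, and \<open>e = p - g z\<close> for the
  residual. The new multiplier \<open>r (g z + v / r - p) = v - r e\<close> is a normal vector to \<open>K\<close> at \<open>p\<close>, hence
  nonpositive on the recession cone, so pairing it with \<open>g\<close> gives a convex function. Its gradient
  inequality, combined with normality at a feasible point \<open>y\<close>, yields
  \<open>\<langle>F z, z - y\<rangle> + r \<parallel>e\<parallel>\<^sup>2 \<le> \<langle>\<L> z, z - y\<rangle> + \<langle>v, e\<rangle>\<close>, which is \<open>aug_Lagrangian_key_inequality\<close>.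
  Everything is read off from this one inequality along the weakly convergent subsequence.

  The term \<open>\<langle>\<L> z, z - y\<rangle>\<close> tends to zero because \<open>\<L> z\<close> does so in norm and \<open>z\<close> converges weakly.
  The residuals tend to zero too. If the penalty parameters stay bounded, the update test eventually
  always succeeds and \<open>V\<close>, which dominates the residual, decays geometrically. If they tend to
  infinity, weak lower semicontinuity bounds \<open>\<langle>F z, z - y\<rangle>\<close> from below, so \<open>r \<parallel>e\<parallel>\<^sup>2\<close> is bounded up to a
  term linear in \<open>\<parallel>e\<parallel>\<close>, and \<open>r \<rightarrow> \<infinity>\<close> forces \<open>e \<rightarrow> 0\<close>.

  Vanishing residuals say that \<open>g\<close> approaches \<open>K\<close> along the subsequence. Concavity of \<open>g\<close> transfers this
  to the weak limit (\<open>weak_limit_asymptotically_feasible\<close>). They also make the right-hand side of the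
  key inequality tend to zero, so weak lower semicontinuity gives \<open>\<langle>F xbar, xbar - y\<rangle> \<le> 0\<close> for every
  feasible \<open>y\<close>, and tangent directions are limits of positive multiples of such differences
  \<open>y - xbar\<close>.\<close>

section \<open>The projection onto a closed convex set of a Hilbert space\<close>

text \<open>By the parallelogram law the points of \<open>K\<close> whose distance to \<open>y\<close> is almost minimal form sets of
  small diameter, so completeness gives them a common point, which is a minimiser.\<close>

lemma metric_projection_minimises:
  fixes K :: "'b::{real_inner, banach} set"
  assumes "K \<noteq> {}" "closed K" "convex K"
  shows "is_arg_min (\<lambda>z. dist y z) (\<lambda>z. z \<in> K) (metric_projection K y)"
proof -
  define d where "d = infdist y K"
  define S where "S n = K \<inter> cball y (d + 1 / real (Suc n))" for n
  have d_le: "d \<le> dist y z" if "z \<in> K" for z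
    unfolding d_def using that by (rule infdist_le)
  have d0: "0 \<le> d"
    unfolding d_def by (rule infdist_nonneg)
  have closed_S: "closed (S n)" for n
    unfolding S_def using assms by auto
  have nonempty_S: "S n \<noteq> {}" for n
  proof -
    have "Inf {dist y a |a. a \<in> K} < d + 1 / real (Suc n)"
      using \<open>K \<noteq> {}\<close> by (simp add: d_def infdist_def setcompr_eq_image)
    then have "\<exists>v\<in>{dist y a |a. a \<in> K}. v < d + 1 / real (Suc n)"
      using \<open>K \<noteq> {}\<close> by (intro cInf_lessD) auto
    then obtain a where "a \<in> K" "dist y a < d + 1 / real (Suc n)"
      by blast
    then show ?thesis
      unfolding S_def by force
  qed
  have mono_S: "S n \<subseteq> S m" if "m \<le> n" for m n
  proof -
    have "1 / real (Suc n) \<le> 1 / real (Suc m)"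
      using that by (simp add: frac_le)
    then show ?thesis
      unfolding S_def by auto
  qed
  have small_S: "\<exists>n. \<forall>a\<in>S n. \<forall>b\<in>S n. dist a b < r" if r: "0 < r" for r
  proof -
    have "(\<lambda>n. 4 * ((d + 1 / real (Suc n))\<^sup>2 - d\<^sup>2)) \<longlonglongrightarrow> 4 * ((d + 0)\<^sup>2 - d\<^sup>2)"
      by (intro tendsto_intros LIMSEQ_Suc lim_1_over_n)
    then have "\<forall>\<^sub>F n in sequentially. 4 * ((d + 1 / real (Suc n))\<^sup>2 - d\<^sup>2) < r\<^sup>2"
      using r by (intro order_tendstoD) auto
    then obtain n where n: "4 * ((d + 1 / real (Suc n))\<^sup>2 - d\<^sup>2) < r\<^sup>2"
      by (auto simp: eventually_sequentially)
    have "dist a b < r" if "a \<in> S n" "b \<in> S n" for a b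
    proof -
      have ab: "a \<in> K" "b \<in> K" "norm (y - a) \<le> d + 1 / real (Suc n)" "norm (y - b) \<le> d + 1 / real (Suc n)"
        using that by (auto simp: S_def dist_norm)
      have "(1/2) *\<^sub>R a + (1/2) *\<^sub>R b \<in> K"
        using ab \<open>convex K\<close> by (intro convexD) auto
      then have "d \<le> norm (y - ((1/2) *\<^sub>R a + (1/2) *\<^sub>R b))"
        using d_le by (simp add: dist_norm)
      then have "d\<^sup>2 \<le> (norm (y - ((1/2) *\<^sub>R a + (1/2) *\<^sub>R b)))\<^sup>2"
        using d0 by (intro power_mono)
      moreover have "(norm (y - a))\<^sup>2 \<le> (d + 1 / real (Suc n))\<^sup>2" "(norm (y - b))\<^sup>2 \<le> (d + 1 / real (Suc n))\<^sup>2"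
        using ab by (auto intro: power_mono)
      \<comment> \<open>the parallelogram law for \<open>y - a\<close> and \<open>y - b\<close>\<close>
      moreover have "(norm (a - b))\<^sup>2 = 2 * (norm (y - a))\<^sup>2 + 2 * (norm (y - b))\<^sup>2
          - 4 * (norm (y - ((1/2) *\<^sub>R a + (1/2) *\<^sub>R b)))\<^sup>2"
        unfolding power2_norm_eq_inner
        by (simp add: inner_diff_left inner_diff_right inner_add_left inner_add_right
            inner_commute algebra_simps)
      ultimately have "(norm (a - b))\<^sup>2 < r\<^sup>2"
        using n by argo
      then show ?thesis
        using r by (simp add: dist_norm power_less_imp_less_base)
    qed
    then show ?thesis
      by blast
  qed
  obtain p where p: "\<And>n. p \<in> S n"
    using decreasing_closed_nest[OF closed_S nonempty_S mono_S small_S] by blast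
  have "(\<lambda>n. d + 1 / real (Suc n)) \<longlonglongrightarrow> d + 0"
    by (intro tendsto_intros LIMSEQ_Suc lim_1_over_n)
  then have "dist y p \<le> d + 0"
    using p by (intro LIMSEQ_le_const) (auto simp: S_def)
  moreover have "p \<in> K"
    using p by (auto simp: S_def)
  ultimately have "is_arg_min (\<lambda>z. dist y z) (\<lambda>z. z \<in> K) p"
    using d_le by (fastforce simp: is_arg_min_linorder)
  then show ?thesis
    unfolding metric_projection_def arg_min_on_def arg_min_def by (rule someI)
qed

lemma metric_projection_in:
  fixes K :: "'b::{real_inner, banach} set"
  assumes "K \<noteq> {}" "closed K" "convex K"
  shows "metric_projection K y \<in> K"
  using metric_projection_minimises[OF assms] by (simp add: is_arg_min_linorder)

lemma metric_projection_normal: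
  fixes K :: "'b::{real_inner, banach} set"
  assumes "K \<noteq> {}" "closed K" "convex K" "q \<in> K"
  shows "(y - metric_projection K y) \<bullet> (q - metric_projection K y) \<le> 0"
proof (rule any_closest_point_dot)
  show "\<forall>z\<in>K. dist y (metric_projection K y) \<le> dist y z"
    using metric_projection_minimises[OF assms(1-3), of y] unfolding is_arg_min_linorder by blast
qed (use assms metric_projection_in in blast)+

section \<open>Concavity with respect to the recession cone\<close>

text \<open>Moving from \<open>p\<close> in a recession direction stays inside \<open>K\<close>, where a normal vector at \<open>p\<close> cannot
  increase.\<close>

lemma normal_nonpos_on_recession_cone:
  assumes "p \<in> K" "\<And>q. q \<in> K \<Longrightarrow> n \<bullet> (q - p) \<le> 0" "d \<in> recession_cone K"
  shows "n \<bullet> d \<le> 0"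
proof -
  have "d + p \<in> K"
    using assms(1,3) by (auto simp: recession_cone_def)
  from assms(2)[OF this] show ?thesis
    by simp
qed

text \<open>After pairing with a functional \<open>n\<close> that is nonpositive on the recession cone, \<open>g\<close> becomes
  an ordinary convex function, and this is its gradient inequality.\<close>

lemma concave_gradient_inequality:
  fixes g :: "'a::real_normed_vector \<Rightarrow> 'b::real_inner"
  assumes concave: "concave_wrt_recession K g"
    and polar: "\<And>d. d \<in> recession_cone K \<Longrightarrow> n \<bullet> d \<le> 0"
    and deriv: "(g has_derivative A) (at a)"
  shows "n \<bullet> A (b - a) \<le> n \<bullet> (g b - g a)"
proof -
  define h where "h t = n \<bullet> g (a + t *\<^sub>R (b - a))" for t
  have lin: "linear A"
    using deriv by (rule has_derivative_linear)
  have "((\<lambda>t. a + t *\<^sub>R (b - a)) has_derivative (\<lambda>t. t *\<^sub>R (b - a))) (at (0::real))"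
    by (auto intro!: derivative_eq_intros)
  moreover have "(g has_derivative A) (at (a + 0 *\<^sub>R (b - a)))"
    using deriv by simp
  ultimately have "((\<lambda>t. g (a + t *\<^sub>R (b - a))) has_derivative (\<lambda>t. A (t *\<^sub>R (b - a)))) (at 0)"
    using has_derivative_compose by blast
  then have "(h has_derivative (\<lambda>t. n \<bullet> A (t *\<^sub>R (b - a)))) (at 0)"
    unfolding h_def by (rule has_derivative_inner_right)
  then have "(h has_field_derivative (n \<bullet> A (b - a))) (at 0)"
    by (simp add: has_field_derivative_def linear_scale[OF lin] mult.commute mult_commute_abs)
  then have "(\<lambda>t. (h t - h 0) / t) \<midarrow>0\<rightarrow> n \<bullet> A (b - a)"
    by (simp add: DERIV_def)
  then have lim: "((\<lambda>t. (h t - h 0) / t) \<longlongrightarrow> n \<bullet> A (b - a)) (at_right 0)"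
    by (rule filterlim_mono) (auto simp: at_le)
  have "(h t - h 0) / t \<le> n \<bullet> (g b - g a)" if t: "0 < t" "t < 1" for t
  proof -
    have "g (t *\<^sub>R b + (1 - t) *\<^sub>R a) - (t *\<^sub>R g b + (1 - t) *\<^sub>R g a) \<in> recession_cone K"
      using concave t by (auto simp: concave_wrt_recession_def le_rec_def)
    moreover have "t *\<^sub>R b + (1 - t) *\<^sub>R a = a + t *\<^sub>R (b - a)"
      by (simp add: algebra_simps)
    ultimately have "n \<bullet> (g (a + t *\<^sub>R (b - a)) - (t *\<^sub>R g b + (1 - t) *\<^sub>R g a)) \<le> 0"
      using polar by metis
    then have "h t - h 0 \<le> t * (n \<bullet> (g b - g a))"
      by (simp add: h_def inner_diff_right inner_add_right algebra_simps)
    then show ?thesis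
      using t by (simp add: field_simps)
  qed
  then have "\<forall>\<^sub>F t in at_right 0. (h t - h 0) / t \<le> n \<bullet> (g b - g a)"
    by (intro eventually_at_rightI[of 0 1]) auto
  with lim show ?thesis
    by (intro tendsto_upperbound[OF lim]) auto
qed

section \<open>Weak convergence\<close>

text \<open>The Banach-Steinhaus theorem: by Baire, one of the closed sets on which the whole family is bounded
  by a fixed integer contains a ball, and by linearity a bound on a ball is a bound on the norms.\<close>

theorem uniform_boundedness:
  fixes T :: "'i \<Rightarrow> 'a::banach \<Rightarrow>\<^sub>L 'b::real_normed_vector"
  assumes pointwise: "\<And>x. \<exists>c. \<forall>i. norm (blinfun_apply (T i) x) \<le> c"
  shows "\<exists>C. \<forall>i. norm (T i) \<le> C"
proof -
  define S where "S m = {x. \<forall>i. norm (blinfun_apply (T i) x) \<le> real m}" for m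
  have closed_S: "closed (S m)" for m
    unfolding S_def by (intro closed_Collect_all closed_Collect_le continuous_intros)
  have "x \<in> (\<Union>m. S m)" for x
  proof -
    obtain c where "\<And>i. norm (blinfun_apply (T i) x) \<le> c"
      using pointwise by blast
    then have "x \<in> S (nat \<lceil>c\<rceil>)"
      unfolding S_def by (smt (verit) mem_Collect_eq real_nat_ceiling_ge)
    then show ?thesis
      by blast
  qed
  then have cover: "(\<Union>m. S m) = UNIV"
    by blast
  have "\<exists>m. interior (S m) \<noteq> {}"
  proof (rule ccontr)
    assume "\<not> ?thesis"
    moreover have "Met_TC.mcomplete TYPE('a)"
      by (simp add: mcomplete_iff_complete complete_UNIV)
    ultimately have "euclidean interior_of (\<Union>(range S)) = {}"
      using closed_S Met_TC.metric_Baire_category_alt[where \<G> = "range S"]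
      by (auto simp: interior_of_openin)
    then show False
      using cover by simp
  qed
  then obtain m a where "a \<in> interior (S m)"
    by blast
  then obtain r where r: "0 < r" "cball a r \<subseteq> S m"
    by (meson mem_interior_cball)
  have "norm (T i) \<le> 2 * real m / r" for i
  proof (rule norm_blinfun_bound)
    show "0 \<le> 2 * real m / r"
      using r by simp
    fix x
    show "norm (blinfun_apply (T i) x) \<le> 2 * real m / r * norm x"
    proof (cases "x = 0")
      case False
      define z where "z = (r / norm x) *\<^sub>R x"
      have "norm z = r"
        using False r by (simp add: z_def)
      then have "a \<in> S m" "a + z \<in> S m"
        using r by (auto simp: dist_norm)
      then have "norm (blinfun_apply (T i) a) \<le> real m" "norm (blinfun_apply (T i) (a + z)) \<le> real m"
        by (auto simp: S_def)
      moreover have "blinfun_apply (T i) z = blinfun_apply (T i) (a + z) - blinfun_apply (T i) a"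
        by (simp add: blinfun.add_right)
      ultimately have "norm (blinfun_apply (T i) z) \<le> 2 * real m"
        using norm_triangle_ineq4[of "blinfun_apply (T i) (a + z)" "blinfun_apply (T i) a"] by simp
      then show ?thesis
        using r False by (simp add: z_def blinfun.scaleR_right field_simps)
    qed simp
  qed
  then show ?thesis
    by blast
qed

lemma weakly_converges_subseq:
  assumes "weakly_converges u a" "filterlim s sequentially sequentially"
  shows "weakly_converges (\<lambda>n. u (s n)) a"
  using assms(1) filterlim_compose[OF _ assms(2)] unfolding weakly_converges_def by blast

lemma weakly_converges_diff_tendsto_0:
  fixes f :: "'a::real_normed_vector \<Rightarrow>\<^sub>L real"
  assumes "weakly_converges u a"
  shows "(\<lambda>n. blinfun_apply f (u n - a)) \<longlonglongrightarrow> 0"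
proof -
  have "(\<lambda>n. blinfun_apply f (u n)) \<longlonglongrightarrow> blinfun_apply f a"
    using assms by (simp add: weakly_converges_def)
  then show ?thesis
    unfolding blinfun.diff_right by (rule LIM_zero)
qed

text \<open>Uniform boundedness is applied to the evaluations at \<open>u n\<close>, as operators on the dual space. It
  bounds \<open>f (u n)\<close> by a multiple of \<open>norm f\<close> for all functionals \<open>f\<close> at once, so passing to a norm bound
  on \<open>u n\<close> itself, which would call for the Hahn-Banach theorem, is avoided.\<close>

lemma norm_null_functionals_on_weakly_convergent:
  fixes u :: "nat \<Rightarrow> 'a::real_normed_vector" and f :: "nat \<Rightarrow> 'a \<Rightarrow>\<^sub>L real"
  assumes weak: "weakly_converges u a" and null: "f \<longlonglongrightarrow> 0"
  shows "(\<lambda>n. blinfun_apply (f n) (u n)) \<longlonglongrightarrow> 0"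
proof -
  define T where "T n = Blinfun (\<lambda>h :: 'a \<Rightarrow>\<^sub>L real. blinfun_apply h (u n))" for n
  have T: "blinfun_apply (T n) h = blinfun_apply h (u n)" for n h
    unfolding T_def by (simp add: bounded_linear_Blinfun_apply blinfun.bounded_linear_left)
  have "\<exists>c. \<forall>n. norm (blinfun_apply (T n) h) \<le> c" for h
  proof -
    have "(\<lambda>n. blinfun_apply h (u n)) \<longlonglongrightarrow> blinfun_apply h a"
      using weak by (simp add: weakly_converges_def)
    then have "Bseq (\<lambda>n. blinfun_apply h (u n))"
      by (intro convergent_imp_Bseq convergentI)
    then show ?thesis
      unfolding T Bseq_def by blast
  qed
  then obtain C where C: "\<And>n. norm (T n) \<le> C"
    using uniform_boundedness[of T] by blast
  have bound: "norm (blinfun_apply (f n) (u n)) \<le> C * norm (f n)" for n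
    using norm_blinfun[of "T n" "f n"] mult_right_mono[OF C norm_ge_zero, of n "f n"]
    unfolding T by linarith
  have "(\<lambda>n. C * norm (f n)) \<longlonglongrightarrow> C * norm (0 :: 'a \<Rightarrow>\<^sub>L real)"
    by (intro tendsto_intros null)
  then have "(\<lambda>n. C * norm (f n)) \<longlonglongrightarrow> 0"
    by simp
  moreover have "\<forall>\<^sub>F n in sequentially. norm (blinfun_apply (f n) (u n)) \<le> C * norm (f n)"
    using bound by simp
  ultimately show ?thesis
    by (rule Lim_null_comparison[rotated])
qed

lemma weakly_seq_lsc_eventually_gt:
  assumes "weakly_seq_lsc \<phi>" "weakly_converges u a" "c < \<phi> a"
  shows "\<forall>\<^sub>F n in sequentially. c < \<phi> (u n)"
proof -
  have "ereal c < liminf (\<lambda>n. ereal (\<phi> (u n)))"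
    using assms unfolding weakly_seq_lsc_def by (auto intro: less_le_trans[of _ "ereal (\<phi> a)"])
  then have "\<forall>\<^sub>F n in sequentially. ereal c < ereal (\<phi> (u n))"
    by (rule less_LiminfD)
  then show ?thesis
    by simp
qed

text \<open>The distance of \<open>g\<close> to \<open>K\<close> is convex and continuous, hence weakly lower semicontinuous; the proof
  makes this explicit with a single functional. Let \<open>m\<close> point from the projection \<open>p\<close> of \<open>g a\<close> to \<open>g a\<close>.
  The gradient inequality at \<open>a\<close> shows that the limit inferior of \<open>m \<bullet> g (u n)\<close> is at least
  \<open>m \<bullet> g a\<close>, while \<open>g (u n)\<close> approaches \<open>K\<close>, on which \<open>m\<close> is at most \<open>m \<bullet> p\<close>. Hence
  \<open>m \<bullet> m \<le> 0\<close>.\<close>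

lemma weak_limit_asymptotically_feasible:
  fixes g :: "'a::real_normed_vector \<Rightarrow> 'b::{real_inner, banach}"
  assumes K: "K \<noteq> {}" "closed K" "convex K"
    and concave: "concave_wrt_recession K g"
    and deriv: "(g has_derivative blinfun_apply A) (at a)"
    and weak: "weakly_converges u a"
    and q: "\<And>n. q n \<in> K" "(\<lambda>n. q n - g (u n)) \<longlonglongrightarrow> 0"
  shows "g a \<in> K"
proof -
  define p where "p = metric_projection K (g a)"
  define m where "m = g a - p"
  have pK: "p \<in> K"
    unfolding p_def using K by (rule metric_projection_in)
  have normal: "m \<bullet> (z - p) \<le> 0" if "z \<in> K" for z
    unfolding m_def p_def using metric_projection_normal[OF K that] .
  have polar: "m \<bullet> d \<le> 0" if "d \<in> recession_cone K" for d
    using normal_nonpos_on_recession_cone[OF pK normal that] .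
  have le: "m \<bullet> blinfun_apply A (u n - a) + m \<bullet> (q n - g (u n)) \<le> - (m \<bullet> m)" for n
  proof -
    have "m \<bullet> blinfun_apply A (u n - a) \<le> m \<bullet> (g (u n) - g a)"
      by (rule concave_gradient_inequality[OF concave polar deriv])
    moreover have "m \<bullet> (g (u n) - g a) + m \<bullet> (q n - g (u n)) = m \<bullet> (q n - p) - m \<bullet> m"
      by (simp add: m_def inner_diff_right)
    ultimately show ?thesis
      using normal[OF q(1), of n] by linarith
  qed
  have "(\<lambda>n. m \<bullet> blinfun_apply A (u n - a)) \<longlonglongrightarrow> 0"
    using weakly_converges_diff_tendsto_0[OF weak, of "blinfun_inner_left m o\<^sub>L A"]
    by (simp add: inner_commute)
  moreover have "(\<lambda>n. m \<bullet> (q n - g (u n))) \<longlonglongrightarrow> m \<bullet> 0"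
    by (intro tendsto_intros q)
  ultimately have "(\<lambda>n. m \<bullet> blinfun_apply A (u n - a) + m \<bullet> (q n - g (u n))) \<longlonglongrightarrow> 0 + m \<bullet> 0"
    by (rule tendsto_add)
  then have "0 + m \<bullet> 0 \<le> - (m \<bullet> m)"
    using le by (intro LIMSEQ_le_const2) auto
  then have "m = 0"
    using inner_ge_zero[of m] by (simp add: order_antisym)
  then show ?thesis
    using pK by (simp add: m_def)
qed

section \<open>Variational inequalities\<close>

lemma solves_VI_if_difference_inequality:
  assumes "a \<in> M" "\<And>y. y \<in> M \<Longrightarrow> 0 \<le> blinfun_apply (F a) (y - a)"
  shows "solves_VI F M a"
  unfolding solves_VI_def
proof (intro conjI ballI)
  fix v assume "v \<in> tangent_cone M a"
  then obtain u t where ut: "\<And>k. u k \<in> M" "\<And>k. 0 < t k" "(\<lambda>k. (u k - a) /\<^sub>R t k) \<longlonglongrightarrow> v"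
    by (auto simp: tangent_cone_def)
  have "(\<lambda>k. blinfun_apply (F a) ((u k - a) /\<^sub>R t k)) \<longlonglongrightarrow> blinfun_apply (F a) v"
    by (intro tendsto_intros ut)
  moreover have "0 \<le> blinfun_apply (F a) ((u k - a) /\<^sub>R t k)" for k
    using assms(2)[OF ut(1)] ut(2)[of k] by (simp add: blinfun.scaleR_right)
  ultimately show "0 \<le> blinfun_apply (F a) v"
    by (intro LIMSEQ_le_const) auto
qed (fact assms)

section \<open>The augmented Lagrangian method\<close>

text \<open>The multiplier \<open>l\<close> of the proof is normal to \<open>K\<close> at the projection \<open>p\<close>. The gradient inequality bounds
  its pairing with the linearised constraint by \<open>l \<bullet> (g y - g z)\<close>; splitting at \<open>p\<close>, the part
  \<open>l \<bullet> (g y - p)\<close> is nonpositive, and the rest is \<open>l \<bullet> e\<close>, where \<open>l = v - r e\<close>.\<close>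

lemma aug_Lagrangian_key_inequality:
  fixes g :: "'a::real_normed_vector \<Rightarrow> 'b::{real_inner, banach}"
  assumes K: "K \<noteq> {}" "closed K" "convex K"
    and concave: "concave_wrt_recession K g"
    and deriv: "(g has_derivative blinfun_apply (g' z)) (at z)"
    and y: "g y \<in> K" and r: "0 < r"
    and e: "e = metric_projection K (g z + v /\<^sub>R r) - g z"
  shows "blinfun_apply (F z) (z - y) + r * (norm e)\<^sup>2
    \<le> blinfun_apply (aug_Lagrangian F g g' K r z v) (z - y) + v \<bullet> e"
proof -
  define p where "p = metric_projection K (g z + v /\<^sub>R r)"
  define l where "l = r *\<^sub>R (g z + v /\<^sub>R r - p)"
  have pK: "p \<in> K"
    unfolding p_def using K by (rule metric_projection_in)
  have normal: "l \<bullet> (q - p) \<le> 0" if "q \<in> K" for q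
    using metric_projection_normal[OF K that, of "g z + v /\<^sub>R r"] r
    by (simp add: l_def p_def mult_le_0_iff)
  have l: "l = v - r *\<^sub>R e"
    using r by (simp add: l_def e p_def algebra_simps)
  have polar: "l \<bullet> d \<le> 0" if "d \<in> recession_cone K" for d
    using normal_nonpos_on_recession_cone[OF pK normal that] .
  have "l \<bullet> blinfun_apply (g' z) (y - z) \<le> l \<bullet> (g y - g z)"
    by (rule concave_gradient_inequality[OF concave polar deriv])
  also have "\<dots> = l \<bullet> (g y - p) + l \<bullet> e"
    by (simp add: e p_def inner_diff_right)
  also have "\<dots> \<le> l \<bullet> e"
    using normal[OF y] by simp
  also have "\<dots> = v \<bullet> e - r * (norm e)\<^sup>2"
    by (simp add: l inner_diff_left power2_norm_eq_inner)
  finally have "l \<bullet> blinfun_apply (g' z) (y - z) \<le> v \<bullet> e - r * (norm e)\<^sup>2" .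
  moreover have "blinfun_apply (aug_Lagrangian F g g' K r z v) (z - y)
      = blinfun_apply (F z) (z - y) - l \<bullet> blinfun_apply (g' z) (y - z)"
    unfolding aug_Lagrangian_def dual_adjoint_def l_def p_def
    by (simp add: blinfun.add_left blinfun.scaleR_left blinfun.diff_right inner_commute
        inner_diff_right algebra_simps)
  ultimately show ?thesis
    by linarith
qed

lemma alm_penalty_mono:
  assumes "alm_sequences F g g' K B \<gamma> \<tau> x \<mu> w \<rho>"
  shows "0 < \<rho> k" "incseq \<rho>"
proof -
  have step: "0 < \<rho> j \<Longrightarrow> 0 < \<rho> (Suc j) \<and> \<rho> j \<le> \<rho> (Suc j)" for j
    using assms unfolding alm_sequences_def by (auto simp: zero_less_mult_iff)
  have pos: "0 < \<rho> j" for j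
    by (induction j) (use assms step in \<open>auto simp: alm_sequences_def\<close>)
  show "0 < \<rho> k" by (fact pos)
  show "incseq \<rho>"
    using step pos by (intro incseq_SucI) blast
qed

text \<open>Each failed test multiplies the penalty parameter by \<open>\<gamma>\<close>. If the parameters have a finite supremum
  \<open>c\<close>, this can no longer happen once they exceed \<open>c / \<gamma>\<close>; from then on \<open>V\<close> contracts by the factor
  \<open>\<tau>\<close> in every step.\<close>

lemma alm_penalty_unbounded_or_residual_null:
  assumes alm: "alm_sequences F g g' K B \<gamma> \<tau> x \<mu> w \<rho>"
  shows "filterlim \<rho> at_top sequentially \<or>
    (\<lambda>k. metric_projection K (g (x (Suc k)) + w k /\<^sub>R \<rho> k) - g (x (Suc k))) \<longlonglongrightarrow> 0"
proof (cases "bdd_above (range \<rho>)")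
  case False
  have "filterlim \<rho> at_top sequentially"
    unfolding filterlim_at_top eventually_sequentially
  proof
    fix Z
    obtain k where "Z < \<rho> k"
      using False by (auto simp: bdd_above_def not_le)
    then show "\<exists>N. \<forall>n\<ge>N. Z \<le> \<rho> n"
      using alm_penalty_mono(2)[OF alm] by (meson incseqD less_imp_le order_trans)
  qed
  then show ?thesis ..
next
  case True
  define V where "V k = alm_V F g g' K (x (Suc k)) (w k) (\<rho> k)" for k
  define c where "c = (SUP k. \<rho> k)"
  have \<gamma>: "1 < \<gamma>" and \<tau>: "0 < \<tau>" "\<tau> < 1"
    using alm by (auto simp: alm_sequences_def)
  have le_c: "\<rho> k \<le> c" for k
    unfolding c_def using True by (simp add: cSUP_upper)
  have c0: "0 < c"
    using alm_penalty_mono(1)[OF alm, of 0] le_c[of 0] by linarith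
  have "c / \<gamma> < c"
    using \<gamma> c0 by (simp add: field_simps)
  then obtain N where N: "c / \<gamma> < \<rho> N"
    unfolding c_def using True by (auto simp: less_cSUP_iff)
  have contract: "V (Suc k) \<le> \<tau> * V k" if "N \<le> k" for k
  proof (rule ccontr)
    assume "\<not> ?thesis"
    then have "\<rho> (Suc (Suc k)) = \<gamma> * \<rho> (Suc k)"
      using alm by (auto simp: alm_sequences_def V_def)
    moreover have "\<rho> N \<le> \<rho> (Suc k)"
      using alm_penalty_mono(2)[OF alm] that by (simp add: incseqD)
    moreover have "c < \<gamma> * \<rho> N"
      using N \<gamma> by (simp add: field_simps)
    ultimately show False
      using le_c[of "Suc (Suc k)"] mult_left_mono[of "\<rho> N" "\<rho> (Suc k)" \<gamma>] \<gamma> by linarith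
  qed
  have geo: "V (N + n) \<le> \<tau> ^ n * V N" for n
  proof (induction n)
    case (Suc n)
    have "V (N + Suc n) \<le> \<tau> * V (N + n)"
      using contract[of "N + n"] by simp
    also have "\<dots> \<le> \<tau> * (\<tau> ^ n * V N)"
      using Suc \<tau> by (intro mult_left_mono) auto
    finally show ?case
      by simp
  qed simp
  define R where "R k = metric_projection K (g (x (Suc k)) + w k /\<^sub>R \<rho> k) - g (x (Suc k))" for k
  have residual: "norm (R k) \<le> V k" for k
    by (simp add: R_def V_def alm_V_def norm_minus_commute)
  have "(\<lambda>n. \<tau> ^ n * V N) \<longlonglongrightarrow> 0 * V N"
    using \<tau> by (intro tendsto_intros LIMSEQ_realpow_zero) auto
  moreover have "norm (R (n + N)) \<le> \<tau> ^ n * V N" for n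
    using residual[of "n + N"] geo[of n] by (simp add: add.commute)
  ultimately have "(\<lambda>n. R (n + N)) \<longlonglongrightarrow> 0"
    by (intro Lim_null_comparison[of "\<lambda>n. R (n + N)" "\<lambda>n. \<tau> ^ n * V N"]) auto
  then have "R \<longlonglongrightarrow> 0"
    by (rule LIMSEQ_offset)
  then show ?thesis
    by (simp add: R_def[abs_def])
qed

text \<open>By Young's inequality the linear term is absorbed into half of the quadratic one, up to \<open>W\<^sup>2 / (2 r)\<close>;
  dividing by \<open>r\<close> leaves a bound on \<open>\<parallel>e\<parallel>\<^sup>2\<close> that tends to zero.\<close>

lemma tendsto_0_of_quadratic_penalty_bound:
  fixes e w :: "nat \<Rightarrow> 'b::real_inner" and r :: "nat \<Rightarrow> real"
  assumes r: "filterlim r at_top sequentially"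
    and w: "\<And>n. norm (w n) \<le> W"
    and bound: "\<forall>\<^sub>F n in sequentially. r n * (norm (e n))\<^sup>2 \<le> c + w n \<bullet> e n"
  shows "e \<longlonglongrightarrow> 0"
proof -
  have r0: "\<forall>\<^sub>F n in sequentially. 0 < r n"
    using r by (simp add: filterlim_at_top_dense)
  have inv: "(\<lambda>n. inverse (r n)) \<longlonglongrightarrow> 0"
    using r by (rule tendsto_inverse_0_at_top)
  have ev: "\<forall>\<^sub>F n in sequentially. norm ((norm (e n))\<^sup>2) \<le> 2 * c * inverse (r n) + W\<^sup>2 * (inverse (r n))\<^sup>2"
    using r0 bound
  proof eventually_elim
    case (elim n)
    have "w n \<bullet> e n \<le> W * norm (e n)"
      using norm_cauchy_schwarz[of "w n" "e n"] mult_right_mono[OF w norm_ge_zero, of n "e n"]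
      by linarith
    then have "r n * (norm (e n))\<^sup>2 \<le> c + W * norm (e n)"
      using elim by linarith
    then have "r n * (r n * (norm (e n))\<^sup>2) \<le> r n * (c + W * norm (e n))"
      using elim by (intro mult_left_mono) auto
    \<comment> \<open>Young's inequality \<open>2 W (r \<parallel>e\<parallel>) \<le> r\<^sup>2 \<parallel>e\<parallel>\<^sup>2 + W\<^sup>2\<close>\<close>
    moreover have "0 \<le> (r n * norm (e n) - W)\<^sup>2"
      by simp
    ultimately have "(r n)\<^sup>2 * (norm (e n))\<^sup>2 \<le> 2 * c * r n + W\<^sup>2"
      by (simp add: power2_eq_square algebra_simps)
    then show ?case
      using elim by (simp add: field_simps power2_eq_square)
  qed
  have "(\<lambda>n. 2 * c * inverse (r n) + W\<^sup>2 * (inverse (r n))\<^sup>2) \<longlonglongrightarrow> 2 * c * 0 + W\<^sup>2 * 0\<^sup>2"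
    by (intro tendsto_intros inv)
  then have "(\<lambda>n. (norm (e n))\<^sup>2) \<longlonglongrightarrow> 0"
    by (intro Lim_null_comparison[OF ev]) simp
  then have "(\<lambda>n. norm (e n)) \<longlonglongrightarrow> 0"
    by (simp add: power_tendsto_0_iff)
  then show ?thesis
    by (simp add: tendsto_norm_zero_iff)
qed

theorem theorem5p4:
  fixes F :: "'a::banach \<Rightarrow> 'a \<Rightarrow>\<^sub>L real"
    and F' :: "'a \<Rightarrow> 'a \<Rightarrow>\<^sub>L ('a \<Rightarrow>\<^sub>L real)"
    and g :: "'a \<Rightarrow> 'b::{real_inner, banach}"
    and g' :: "'a \<Rightarrow> 'a \<Rightarrow>\<^sub>L 'b"
    and g'' :: "'a \<Rightarrow> 'a \<Rightarrow>\<^sub>L ('a \<Rightarrow>\<^sub>L 'b)"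
    and K B :: "'b set"
    and \<gamma> \<tau> :: real
    and x :: "nat \<Rightarrow> 'a"
    and \<mu> w :: "nat \<Rightarrow> 'b"
    and \<rho> \<epsilon> :: "nat \<Rightarrow> real"
    and xbar :: 'a
  assumes "K \<noteq> {}" and "closed K" and "convex K"
    and "\<And>z. (F has_derivative blinfun_apply (F' z)) (at z)"
    and "continuous_on UNIV F'"
    and "\<And>z. (g has_derivative blinfun_apply (g' z)) (at z)"
    and "\<And>z. (g' has_derivative blinfun_apply (g'' z)) (at z)"
    and "continuous_on UNIV g''"
    and "concave_wrt_recession K g"
    and "\<And>y. weakly_seq_lsc (\<lambda>z. blinfun_apply (F z) (z - y))"
    and "alm_sequences F g g' K B \<gamma> \<tau> x \<mu> w \<rho>"
    and "\<And>k. 0 \<le> \<epsilon> k" and "\<epsilon> \<longlonglongrightarrow> 0"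
    and "\<And>k. norm (aug_Lagrangian F g g' K (\<rho> k) (x (Suc k)) (w k)) \<le> \<epsilon> (Suc k)"
    and "weak_limit_point x xbar"
    and "feasible_set g K \<noteq> {}"
  shows "xbar \<in> feasible_set g K \<and> solves_VI F (feasible_set g K) xbar"
proof -
  note K = assms(1-3) and deriv = assms(6) and concave = assms(9) and lsc = assms(10)
    and alm = assms(11)
  obtain s where s: "strict_mono s" "weakly_converges (x \<circ> s) xbar"
    using assms(15) by (auto simp: weak_limit_point_def)
  \<comment> \<open>nothing is known about \<open>x 0\<close>, so the first term of the subsequence is dropped and every other
    index is written as a successor\<close>
  define j where "j n = s (Suc n) - 1" for n
  have Suc_j: "Suc (j n) = s (Suc n)" for n
    using strict_mono_imp_increasing[OF s(1), of "Suc n"] by (simp add: j_def)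
  have "Suc (j n) < Suc (j (Suc n))" for n
    unfolding Suc_j using s(1) by (simp add: strict_mono_less)
  then have "strict_mono j"
    by (simp add: strict_mono_Suc_iff)
  then have j: "filterlim j sequentially sequentially"
    by (rule filterlim_subseq)
  define u where "u n = x (Suc (j n))" for n
  have weak: "weakly_converges u xbar"
    using weakly_converges_subseq[OF s(2) filterlim_Suc] by (simp add: u_def[abs_def] Suc_j)
  define q where "q n = metric_projection K (g (u n) + w (j n) /\<^sub>R \<rho> (j n))" for n
  define e where "e n = q n - g (u n)" for n
  define L where "L n = aug_Lagrangian F g g' K (\<rho> (j n)) (u n) (w (j n))" for n
  have qK: "q n \<in> K" for n
    unfolding q_def using K by (rule metric_projection_in)
  obtain W where W: "norm (w k) \<le> W" for k
    using alm by (auto simp: alm_sequences_def bounded_iff)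
  have key: "blinfun_apply (F (u n)) (u n - y) + \<rho> (j n) * (norm (e n))\<^sup>2
      \<le> blinfun_apply (L n) (u n - y) + w (j n) \<bullet> e n" if "g y \<in> K" for n y
    unfolding L_def
    by (rule aug_Lagrangian_key_inequality[OF K concave deriv that alm_penalty_mono(1)[OF alm]])
      (simp add: e_def q_def)
  have "(\<lambda>n. \<epsilon> (Suc (j n))) \<longlonglongrightarrow> 0"
    using filterlim_compose[OF LIMSEQ_Suc[OF assms(13)] j] .
  then have L0: "L \<longlonglongrightarrow> 0"
    using assms(14) by (intro Lim_null_comparison[of L]) (auto simp: L_def u_def)
  have L_diff: "(\<lambda>n. blinfun_apply (L n) (u n - y)) \<longlonglongrightarrow> 0" for y
  proof -
    have "(\<lambda>n. blinfun_apply (L n) (u n) - blinfun_apply (L n) y) \<longlonglongrightarrow> 0 - blinfun_apply 0 y"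
      by (intro tendsto_intros norm_null_functionals_on_weakly_convergent[OF weak L0] L0)
    then show ?thesis
      by (simp add: blinfun.diff_right)
  qed
  obtain y0 where y0: "g y0 \<in> K"
    using assms(16) by (auto simp: feasible_set_def)

  have e0: "e \<longlonglongrightarrow> 0"
    using alm_penalty_unbounded_or_residual_null[OF alm]
  proof
    assume "filterlim \<rho> at_top sequentially"
    then have \<rho>_top: "filterlim (\<lambda>n. \<rho> (j n)) at_top sequentially"
      using j by (rule filterlim_compose)
    define c where "c = blinfun_apply (F xbar) (xbar - y0)"
    \<comment> \<open>any real below \<open>c\<close> serves as an eventual lower bound; \<open>c - 1\<close> and the upper bound \<open>1\<close> on the
      Lagrangian term combine to the constant \<open>2 - c\<close>\<close>
    have "\<forall>\<^sub>F n in sequentially. c - 1 < blinfun_apply (F (u n)) (u n - y0)"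
      by (rule weakly_seq_lsc_eventually_gt[OF lsc weak]) (simp add: c_def)
    moreover have "\<forall>\<^sub>F n in sequentially. blinfun_apply (L n) (u n - y0) < 1"
      by (rule order_tendstoD[OF L_diff]) simp
    ultimately have "\<forall>\<^sub>F n in sequentially. \<rho> (j n) * (norm (e n))\<^sup>2 \<le> (2 - c) + w (j n) \<bullet> e n"
      by eventually_elim (use key[OF y0] in \<open>smt (verit)\<close>)
    then show ?thesis
      by (rule tendsto_0_of_quadratic_penalty_bound[OF \<rho>_top W])
  next
    assume "(\<lambda>k. metric_projection K (g (x (Suc k)) + w k /\<^sub>R \<rho> k) - g (x (Suc k))) \<longlonglongrightarrow> 0"
    then show ?thesis
      using filterlim_compose[OF _ j] unfolding e_def q_def u_def by blast
  qed

  have feasible: "xbar \<in> feasible_set g K"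
    using weak_limit_asymptotically_feasible[where q = q, OF K concave deriv weak qK] e0
    by (simp add: e_def[abs_def] feasible_set_def)
  have we0: "(\<lambda>n. w (j n) \<bullet> e n) \<longlonglongrightarrow> 0"
  proof (rule Lim_null_comparison)
    have "norm (w (j n) \<bullet> e n) \<le> W * norm (e n)" for n
      using Cauchy_Schwarz_ineq2[of "w (j n)" "e n"] mult_right_mono[OF W norm_ge_zero, of "j n" "e n"]
      by simp
    then show "\<forall>\<^sub>F n in sequentially. norm (w (j n) \<bullet> e n) \<le> W * norm (e n)"
      by simp
    show "(\<lambda>n. W * norm (e n)) \<longlonglongrightarrow> 0"
      using tendsto_mult_left[OF tendsto_norm[OF e0], of W] by simp
  qed
  have "0 \<le> blinfun_apply (F xbar) (y - xbar)" if y: "y \<in> feasible_set g K" for y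
  proof (rule ccontr)
    define c where "c = blinfun_apply (F xbar) (xbar - y)"
    assume "\<not> ?thesis"
    then have c: "0 < c"
      by (simp add: c_def blinfun.diff_right)
    have "(\<lambda>n. blinfun_apply (L n) (u n - y) + w (j n) \<bullet> e n) \<longlonglongrightarrow> 0 + 0"
      by (intro tendsto_add L_diff we0)
    then have "\<forall>\<^sub>F n in sequentially. blinfun_apply (L n) (u n - y) + w (j n) \<bullet> e n < c / 2"
      using c by (intro order_tendstoD) auto
    moreover have "\<forall>\<^sub>F n in sequentially. c / 2 < blinfun_apply (F (u n)) (u n - y)"
      by (rule weakly_seq_lsc_eventually_gt[OF lsc weak]) (use c in \<open>simp add: c_def\<close>)
    ultimately have "\<forall>\<^sub>F n in sequentially. False"
    proof eventually_elim
      case (elim n)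
      have "0 \<le> \<rho> (j n) * (norm (e n))\<^sup>2"
        using alm_penalty_mono(1)[OF alm, of "j n"] by simp
      then show ?case
        using key[of y n] y elim by (simp add: feasible_set_def)
    qed
    then show False
      by simp
  qed
  with feasible show ?thesis
    by (blast intro: solves_VI_if_difference_inequality)
qed

end
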